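(* Let $\mathcal{A}$ be a $\mathbf{tDL}$-algebra. The lattice $C^{\downarrow}_t(X(A))$ of all downward closed $\mathbf{tPS}$-sets of $(X(A),R_A)$ is isomorphic to the dual of the lattice $\mathcal{I}_t(A)$ of all tense ideals of $\mathcal{A}$; the anti-isomorphism is $Z\mapsto\varrho(Z)=\left(\bigcup_{T\in Z}T\right)^c$, with inverse $I\mapsto\sigma(I)=\{T\in X(A):T\cap I=\emptyset\}$.
   Context: A $\mathbf{tDL}$-algebra is a bounded distributive lattice $\langle A,\wedge,\vee,0,1\rangle$ with unary operators $\mathbf{G},\mathbf{H},\mathbf{F},\mathbf{P}$ such that for all $x,y$: $\mathbf{G}1=\mathbf{H}1=1$; $\mathbf{G},\mathbf{H}$ preserve $\wedge$; $x\le\mathbf{G}\mathbf{P}x$, $x\le\mathbf{H}\mathbf{F}x$; $\mathbf{G}(x\vee y)\le\mathbf{G}x\vee\mathbf{F}y$, $\mathbf{H}(x\vee y)\le\mathbf{H}x\vee\mathbf{P}y$; $\mathbf{F}0=\mathbf{P}0=0$; $\mathbf{F},\mathbf{P}$ preserve $\vee$; $\mathbf{P}\mathbf{G}x\le x$, $\mathbf{F}\mathbf{H}x\le x$; $\mathbf{G}x\wedge\mathbf{F}y\le\mathbf{F}(x\wedge y)$, $\mathbf{H}x\wedge\mathbf{P}y\le\mathbf{P}(x\wedge y)$. A tense ideal is a lattice ideal $I$ with $\mathbf{F}x,\mathbf{P}x\in I$ for all $x\in I$; complements are taken in $A$. $X(A)$ is the set of prime filters ordered by inclusion with the Priestley topology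 generated by the sets $\sigma_A(a)=\{T\in X(A):a\in T\}$ and their complements; $(S,T)\in R_A$ iff $\{a:\mathbf{G}a\in S\}\subseteq T\subseteq\{a:\mathbf{F}a\in S\}$. With $R_A(x)=\{y:(x,y)\in R_A\}$, $R_A^{-1}(x)=\{y:(y,x)\in R_A\}$, a subset $Y\subseteq X(A)$ is a $\mathbf{tPS}$-set if for all $x,y$: (tc1) if $x\in R_A^{-1}(y)\cap Y$ then there are $w_1,w_2\in R_A(x)\cap Y$ with $w_1\subseteq y\subseteq w_2$; (tc2) if $x\in R_A(y)\cap Y$ then there are $w_1,w_2\in R_A^{-1}(x)\cap Y$ with $w_1\subseteq y\subseteq w_2$. $C^{\downarrow}_t(X(A))$ is the set of $\mathbf{tPS}$-sets that are closed and downward closed (w.r.t. inclusion). *)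

theory Defs
  imports "HOL-Algebra.Lattice" "HOL-Analysis.Abstract_Topology"
begin

text \<open>The names \<open>inf\<close>, \<open>sup\<close>, \<open>top\<close> below are the type class operations; the homonymous constants
  of the record-based lattices stay accessible by qualified names.\<close>

hide_const (open) Lattice.inf Lattice.sup Order.top Order.bottom

text \<open>The algebra is the whole type. The class \<open>bounded_lattice\<close> does not require
  \<open>bot \<noteq> top\<close>, so the one-element algebra is included.\<close>

locale tDL_algebra =
  fixes G H F P :: "'a::{distrib_lattice,bounded_lattice} \<Rightarrow> 'a"
  assumes G_top: "G top = top"
    and H_top: "H top = top"
    and G_inf: "G (inf x y) = inf (G x) (G y)"
    and H_inf: "H (inf x y) = inf (H x) (H y)"
    and le_G_P: "x \<le> G (P x)"
    and le_H_F: "x \<le> H (F x)"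
    and G_sup_le: "G (sup x y) \<le> sup (G x) (F y)"
    and H_sup_le: "H (sup x y) \<le> sup (H x) (P y)"
    and F_bot: "F bot = bot"
    and P_bot: "P bot = bot"
    and F_sup: "F (sup x y) = sup (F x) (F y)"
    and P_sup: "P (sup x y) = sup (P x) (P y)"
    and P_G_le: "P (G x) \<le> x"
    and F_H_le: "F (H x) \<le> x"
    and inf_G_F_le: "inf (G x) (F y) \<le> F (inf x y)"
    and inf_H_P_le: "inf (H x) (P y) \<le> P (inf x y)"

text \<open>Lattice ideals are nonempty but not necessarily proper: the whole algebra is the tense ideal
  corresponding to the empty set of prime filters.\<close>

definition lattice_ideal :: "'a::lattice set \<Rightarrow> bool" where
  "lattice_ideal I \<longleftrightarrow> I \<noteq> {} \<and> (\<forall>x\<in>I. \<forall>y. y \<le> x \<longrightarrow> y \<in> I) \<and> (\<forall>x\<in>I. \<forall>y\<in>I. sup x y \<in> I)"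

definition tense_ideal :: "('a::lattice \<Rightarrow> 'a) \<Rightarrow> ('a \<Rightarrow> 'a) \<Rightarrow> 'a set \<Rightarrow> bool" where
  "tense_ideal F P I \<longleftrightarrow> lattice_ideal I \<and> (\<forall>x\<in>I. F x \<in> I \<and> P x \<in> I)"

definition lattice_filter :: "'a::lattice set \<Rightarrow> bool" where
  "lattice_filter T \<longleftrightarrow> T \<noteq> {} \<and> (\<forall>x\<in>T. \<forall>y. x \<le> y \<longrightarrow> y \<in> T) \<and> (\<forall>x\<in>T. \<forall>y\<in>T. inf x y \<in> T)"

definition prime_filter :: "'a::lattice set \<Rightarrow> bool" where
  "prime_filter T \<longleftrightarrow>
    lattice_filter T \<and> T \<noteq> UNIV \<and> (\<forall>x y. sup x y \<in> T \<longrightarrow> x \<in> T \<or> y \<in> T)"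

definition prime_filters :: "'a::lattice set set" where
  "prime_filters = {T. prime_filter T}"

definition sigma :: "'a::lattice \<Rightarrow> 'a set set" where
  "sigma a = {T \<in> prime_filters. a \<in> T}"

definition priestley_topology :: "'a::lattice set topology" where
  "priestley_topology =
    topology_generated_by (range sigma \<union> range (\<lambda>a. prime_filters - sigma a))"

definition canonical_rel :: "('a::lattice \<Rightarrow> 'a) \<Rightarrow> ('a \<Rightarrow> 'a) \<Rightarrow> ('a set \<times> 'a set) set" where
  "canonical_rel G F =
    {(S, T). S \<in> prime_filters \<and> T \<in> prime_filters \<and> {a. G a \<in> S} \<subseteq> T \<and> T \<subseteq> {a. F a \<in> S}}"

text \<open>\<open>R `` {x}\<close> is \<open>R(x)\<close>, and \<open>R\<inverse> `` {x}\<close> is the set of all \<open>y\<close> with \<open>(y, x) \<in> R\<close>.\<close>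

definition tPS_set :: "('a::lattice \<Rightarrow> 'a) \<Rightarrow> ('a \<Rightarrow> 'a) \<Rightarrow> 'a set set \<Rightarrow> bool" where
  "tPS_set G F Y \<longleftrightarrow> Y \<subseteq> prime_filters \<and>
    (let R = canonical_rel G F in
      \<forall>x\<in>prime_filters. \<forall>y\<in>prime_filters.
        (x \<in> R\<inverse> `` {y} \<inter> Y \<longrightarrow>
          (\<exists>w1 \<in> R `` {x} \<inter> Y. \<exists>w2 \<in> R `` {x} \<inter> Y. w1 \<subseteq> y \<and> y \<subseteq> w2)) \<and>
        (x \<in> R `` {y} \<inter> Y \<longrightarrow>
          (\<exists>w1 \<in> R\<inverse> `` {x} \<inter> Y. \<exists>w2 \<in> R\<inverse> `` {x} \<inter> Y. w1 \<subseteq> y \<and> y \<subseteq> w2)))"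

definition downward_closed :: "'a::lattice set set \<Rightarrow> bool" where
  "downward_closed Z \<longleftrightarrow> Z \<subseteq> prime_filters \<and> (\<forall>T\<in>Z. \<forall>S\<in>prime_filters. S \<subseteq> T \<longrightarrow> S \<in> Z)"

definition inclusion_order :: "'b set set \<Rightarrow> 'b set gorder" where
  "inclusion_order C = \<lparr>carrier = C, eq = (=), le = (\<subseteq>)\<rparr>"

definition tPS_downset_lattice :: "('a::lattice \<Rightarrow> 'a) \<Rightarrow> ('a \<Rightarrow> 'a) \<Rightarrow> 'a set set gorder" where
  "tPS_downset_lattice G F =
    inclusion_order {Z. tPS_set G F Z \<and> closedin priestley_topology Z \<and> downward_closed Z}"

definition tense_ideal_lattice :: "('a::lattice \<Rightarrow> 'a) \<Rightarrow> ('a \<Rightarrow> 'a) \<Rightarrow> 'a set gorder" where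
  "tense_ideal_lattice F P = inclusion_order {I. tense_ideal F P I}"

text \<open>Since \<open>join_pres\<close> and \<open>meet_pres\<close> contain the lattice axioms for both structures, this says in
  particular that \<open>L\<close> and \<open>M\<close> are lattices.\<close>

definition lattice_isomorphism :: "'b gorder \<Rightarrow> 'c gorder \<Rightarrow> ('b \<Rightarrow> 'c) \<Rightarrow> bool" where
  "lattice_isomorphism L M f \<longleftrightarrow>
    bij_betw f (carrier L) (carrier M) \<and> join_pres L M f \<and> meet_pres L M f"

definition rho :: "'a set set \<Rightarrow> 'a set" where
  "rho Z = - (\<Union>T\<in>Z. T)"

definition sigma_ideal :: "'a::lattice set \<Rightarrow> 'a set set" where
  "sigma_ideal I = {T \<in> prime_filters. T \<inter> I = {}}"

end

(* A prime filter separates a filter from a disjoint ideal, which gives rho (sigma I) = I. For a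
   closed downset Z and a prime filter T contained in the union of Z, compactness applied to Z and the
   sets sigma a with a in T yields a member of Z above T, so sigma (rho Z) = Z; the relation R
   plays no role here. Tenseness is matched with (tc1) and (tc2) as follows. If I is a tense ideal, then
   sigma I is closed under R-successors and R-predecessors, so both conditions hold with
   w1 = w2 = y. If Z is a tPS-set and F a lies in S for some S in Z, then separation gives an
   R-successor of S containing a, and (tc1) replaces it by a larger one inside Z; P is treated
   in the same way through the symmetry exchanging G, F with H, P. *)

theory Submission
  imports Defs "HOL-Analysis.Function_Topology"
begin

section \<open>Order isomorphisms of record-based lattices\<close>

text \<open>An order isomorphism carries the upper bounds of \<open>A\<close> exactly onto the upper
  bounds of the image, and hence least elements onto least elements.\<close>

lemma is_lub_iso:
  assumes bij: "bij_betw f (carrier L) (carrier M)"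
    and le: "\<And>x y. x \<in> carrier L \<Longrightarrow> y \<in> carrier L \<Longrightarrow> x \<sqsubseteq>\<^bsub>L\<^esub> y \<longleftrightarrow> f x \<sqsubseteq>\<^bsub>M\<^esub> f y"
    and A: "A \<subseteq> carrier L" and s: "s \<in> carrier L"
  shows "is_lub L s A \<longleftrightarrow> is_lub M (f s) (f ` A)"
proof -
  have carr: "carrier M = f ` carrier L"
    using bij by (simp add: bij_betw_def)
  have inj: "inj_on f (carrier L)"
    using bij by (simp add: bij_betw_def)
  have Upper: "Upper M (f ` A) = f ` Upper L A"
  proof -
    have "f u \<in> Upper M (f ` A) \<longleftrightarrow> u \<in> Upper L A" if u: "u \<in> carrier L" for u
    proof -
      have "(\<forall>x\<in>A. f x \<sqsubseteq>\<^bsub>M\<^esub> f u) \<longleftrightarrow> (\<forall>x\<in>A. x \<sqsubseteq>\<^bsub>L\<^esub> u)"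
        using A le u by blast
      moreover have "f ` A \<inter> carrier M = f ` A" "A \<inter> carrier L = A"
        using A carr by blast+
      ultimately show ?thesis
        using u unfolding Upper_def by (simp add: carr Ball_def image_iff) blast
    qed
    moreover have "\<exists>u\<in>carrier L. v = f u" if "v \<in> Upper M (f ` A)" for v
      using Upper_closed[of M "f ` A", THEN subsetD, OF that] by (simp add: carr image_iff)
    moreover have "u \<in> carrier L" if "u \<in> Upper L A" for u
      using Upper_closed[of L A] that by blast
    ultimately show ?thesis by fast
  qed
  have "f s \<in> f ` Upper L A \<longleftrightarrow> s \<in> Upper L A"
    using inj s by (meson Upper_closed inj_on_image_mem_iff)
  moreover have "(\<forall>x\<in>Upper L A. f s \<sqsubseteq>\<^bsub>M\<^esub> f x) \<longleftrightarrow> (\<forall>x\<in>Upper L A. s \<sqsubseteq>\<^bsub>L\<^esub> x)"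
    using le s Upper_closed[of L A] by blast
  moreover have "f ` Upper L A \<subseteq> carrier M"
    unfolding carr by (rule image_mono[OF Upper_closed])
  moreover have "Upper L A \<subseteq> carrier L" by (rule Upper_closed)
  ultimately show ?thesis
    unfolding least_def Upper ball_simps by (iprover intro: iffI)
qed

text \<open>Dual of \<open>is_lub_iso\<close>: greatest lower bounds are least upper bounds for
  \<open>inv_gorder\<close>.\<close>

lemma is_glb_iso:
  assumes "bij_betw f (carrier L) (carrier M)"
    and "\<And>x y. x \<in> carrier L \<Longrightarrow> y \<in> carrier L \<Longrightarrow> x \<sqsubseteq>\<^bsub>L\<^esub> y \<longleftrightarrow> f x \<sqsubseteq>\<^bsub>M\<^esub> f y"
    and "A \<subseteq> carrier L" and "s \<in> carrier L"
  shows "is_glb L s A \<longleftrightarrow> is_glb M (f s) (f ` A)"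
  using is_lub_iso[of f "inv_gorder L" "inv_gorder M" A s] assms by simp

text \<open>Bounds of pairs in \<open>M\<close> are pulled back along \<open>f\<close>, so the
  lattice property passes from \<open>M\<close> to \<open>L\<close>. This spares an explicit
  description of joins and meets of closed downward closed tPS-sets.\<close>

lemma
  assumes L: "partial_order L" and M: "Lattice.lattice M"
    and bij: "bij_betw f (carrier L) (carrier M)"
    and le: "\<And>x y. x \<in> carrier L \<Longrightarrow> y \<in> carrier L \<Longrightarrow> x \<sqsubseteq>\<^bsub>L\<^esub> y \<longleftrightarrow> f x \<sqsubseteq>\<^bsub>M\<^esub> f y"
  shows order_iso_imp_lattice: "Lattice.lattice L"
    and order_iso_imp_lattice_isomorphism: "lattice_isomorphism L M f"
proof -
  interpret L: partial_order L by fact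
  interpret M: Lattice.lattice M by fact
  have mem: "f x \<in> carrier M" if "x \<in> carrier L" for x
    using bij that by (rule bij_betwE[THEN bspec])
  have surj: "\<exists>x\<in>carrier L. f x = z" if "z \<in> carrier M" for z
  proof -
    have "z \<in> f ` carrier L" using bij that by (simp add: bij_betw_imp_surj_on)
    then show ?thesis by fast
  qed
  have lub: "is_lub L s {x, y} \<longleftrightarrow> is_lub M (f s) {f x, f y}"
    and glb: "is_glb L s {x, y} \<longleftrightarrow> is_glb M (f s) {f x, f y}"
    if "x \<in> carrier L" "y \<in> carrier L" "s \<in> carrier L" for x y s
    using is_lub_iso[OF bij le, of "{x, y}" s] is_glb_iso[OF bij le, of "{x, y}" s] that by auto
  have lattice: "Lattice.lattice L"
  proof
    fix x y assume xy: "x \<in> carrier L" "y \<in> carrier L"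
    show "\<exists>s. is_lub L s {x, y}"
    proof -
      obtain t where t: "is_lub M t {f x, f y}"
        using M.sup_of_two_exists[OF mem[OF xy(1)] mem[OF xy(2)]] ..
      obtain s where "s \<in> carrier L" "f s = t"
        using surj[OF least_closed[OF t]] by blast
      with t lub[OF xy] show ?thesis by blast
    qed
    show "\<exists>s. is_glb L s {x, y}"
    proof -
      obtain t where t: "is_glb M t {f x, f y}"
        using M.inf_of_two_exists[OF mem[OF xy(1)] mem[OF xy(2)]] ..
      obtain s where "s \<in> carrier L" "f s = t"
        using surj[OF greatest_closed[OF t]] by blast
      with t glb[OF xy] show ?thesis by blast
    qed
  qed
  then show "Lattice.lattice L" .
  interpret L: Lattice.lattice L by fact
  have "f (x \<squnion>\<^bsub>L\<^esub> y) = f x \<squnion>\<^bsub>M\<^esub> f y" if xy: "x \<in> carrier L" "y \<in> carrier L" for x y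
  \<comment> \<open>The joins are traded for arbitrary least upper bounds \<open>l\<close> and
    \<open>m\<close>, which \<open>lub\<close> and uniqueness identify.\<close>
  proof (rule L.joinI[OF _ xy], rule M.joinI[OF _ mem[OF xy(1)] mem[OF xy(2)]])
    fix l m assume "is_lub L l {x, y}" "is_lub M m {f x, f y}"
    then show "f l = m"
      using lub[OF xy] by (metis M.least_unique least_closed)
  qed
  moreover have "f (x \<sqinter>\<^bsub>L\<^esub> y) = f x \<sqinter>\<^bsub>M\<^esub> f y" if xy: "x \<in> carrier L" "y \<in> carrier L" for x y
  proof (rule L.meetI[OF _ xy], rule M.meetI[OF _ mem[OF xy(1)] mem[OF xy(2)]])
    fix l m assume "is_glb L l {x, y}" "is_glb M m {f x, f y}"
    then show "f l = m"
      using glb[OF xy] by (metis M.greatest_unique greatest_closed)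
  qed
  ultimately show "lattice_isomorphism L M f"
    using lattice M bij by (simp add: lattice_isomorphism_def join_pres_def meet_pres_def)
qed

lemma inclusion_order_simps [simp]:
  "carrier (inclusion_order C) = C"
  "eq (inclusion_order C) = (=)"
  "le (inclusion_order C) = (\<subseteq>)"
  by (simp_all add: inclusion_order_def)

lemma partial_order_inclusion_order: "partial_order (inclusion_order C)"
  by unfold_locales auto

section \<open>Separation by prime filters\<close>

lemma lattice_filterD:
  assumes "lattice_filter T"
  shows lattice_filter_nonempty: "\<exists>x. x \<in> T"
    and lattice_filter_up: "x \<in> T \<Longrightarrow> x \<le> y \<Longrightarrow> y \<in> T"
    and lattice_filter_inf: "x \<in> T \<Longrightarrow> y \<in> T \<Longrightarrow> inf x y \<in> T"
  using assms by (auto simp: lattice_filter_def)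

lemma lattice_idealD:
  assumes "lattice_ideal I"
  shows lattice_ideal_nonempty: "\<exists>x. x \<in> I"
    and lattice_ideal_down: "x \<in> I \<Longrightarrow> y \<le> x \<Longrightarrow> y \<in> I"
    and lattice_ideal_sup: "x \<in> I \<Longrightarrow> y \<in> I \<Longrightarrow> sup x y \<in> I"
  using assms by (auto simp: lattice_ideal_def)

lemma prime_filterD:
  assumes "prime_filter T"
  shows prime_filter_imp_lattice_filter: "lattice_filter T"
    and prime_filter_proper: "\<exists>x. x \<notin> T"
    and prime_filter_sup: "sup x y \<in> T \<Longrightarrow> x \<in> T \<or> y \<in> T"
  using assms by (auto simp: prime_filter_def)

text \<open>This is the filter generated by \<open>D\<close> and \<open>a\<close>. It serves the
  maximality argument in the separation theorem and the construction of successors under the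
  canonical relation.\<close>

lemma lattice_filter_adjoin:
  fixes D :: "'a::lattice set"
  assumes "lattice_filter D"
  shows "lattice_filter {z. \<exists>d\<in>D. inf d a \<le> z}"
  unfolding lattice_filter_def
proof (intro conjI ballI allI impI)
  show "{z. \<exists>d\<in>D. inf d a \<le> z} \<noteq> {}"
    using lattice_filter_nonempty[OF assms] by auto
next
  fix x y assume "x \<in> {z. \<exists>d\<in>D. inf d a \<le> z}" "x \<le> y"
  then show "y \<in> {z. \<exists>d\<in>D. inf d a \<le> z}" by (blast intro: order_trans)
next
  fix x y assume "x \<in> {z. \<exists>d\<in>D. inf d a \<le> z}" "y \<in> {z. \<exists>d\<in>D. inf d a \<le> z}"
  then obtain d e where de: "d \<in> D" "inf d a \<le> x" "e \<in> D" "inf e a \<le> y" by auto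
  have "inf (inf d e) a \<le> inf x y"
    using de by (meson inf_greatest inf_le1 inf_le2 inf_mono order_refl order_trans)
  moreover have "inf d e \<in> D"
    using assms de by (blast intro: lattice_filter_inf)
  ultimately show "inf x y \<in> {z. \<exists>d\<in>D. inf d a \<le> z}" by blast
qed

text \<open>Two elements of the union already lie in one member of the chain, so closure under
  \<open>inf\<close> is inherited. This supplies the upper bounds for Zorn's lemma.\<close>

lemma lattice_filter_Union_chain:
  assumes "\<C> \<noteq> {}" and "subset.chain (Collect lattice_filter) \<C>"
  shows "lattice_filter (\<Union>\<C>)"
proof -
  have fil: "lattice_filter T" if "T \<in> \<C>" for T
    using assms(2) that by (auto simp: subset.chain_def)
  have tot: "T \<subseteq> S \<or> S \<subseteq> T" if "T \<in> \<C>" "S \<in> \<C>" for T S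
    using assms(2) that by (auto simp: subset.chain_def)
  show ?thesis
    unfolding lattice_filter_def
  proof (intro conjI ballI allI impI)
    show "\<Union>\<C> \<noteq> {}"
      using assms(1) fil lattice_filter_nonempty by fast
  next
    fix x y assume "x \<in> \<Union>\<C>" "x \<le> y"
    then show "y \<in> \<Union>\<C>" using fil lattice_filter_up by fast
  next
    fix x y assume "x \<in> \<Union>\<C>" "y \<in> \<Union>\<C>"
    then obtain T S where "T \<in> \<C>" "x \<in> T" "S \<in> \<C>" "y \<in> S" by auto
    then obtain W where "W \<in> \<C>" "x \<in> W" "y \<in> W"
      using tot by blast
    then show "inf x y \<in> \<Union>\<C>"
      using lattice_filter_inf[OF fil] by blast
  qed
qed

text \<open>Zorn's lemma gives a filter \<open>M\<close> maximal among those that extend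
  \<open>D\<close> and miss \<open>I\<close>; maximality and distributivity make \<open>M\<close>
  prime.\<close>

lemma prime_filter_separation:
  fixes D I :: "'a::distrib_lattice set"
  assumes D: "lattice_filter D" and I: "lattice_ideal I" and disj: "D \<inter> I = {}"
  obtains T where "prime_filter T" "D \<subseteq> T" "T \<inter> I = {}"
proof -
  define \<A> where "\<A> = {T. lattice_filter T \<and> D \<subseteq> T \<and> T \<inter> I = {}}"
  have "\<exists>M\<in>\<A>. \<forall>X\<in>\<A>. M \<subseteq> X \<longrightarrow> X = M"
  proof (rule subset_Zorn_nonempty)
    show "\<A> \<noteq> {}" using D disj by (auto simp: \<A>_def)
  next
    fix \<C> assume ne: "\<C> \<noteq> {}" and ch: "subset.chain \<A> \<C>"
    have "subset.chain (Collect lattice_filter) \<C>"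
      using ch by (auto simp: subset.chain_def \<A>_def)
    with ne have "lattice_filter (\<Union>\<C>)" by (rule lattice_filter_Union_chain)
    then show "\<Union>\<C> \<in> \<A>"
      using ne ch unfolding subset.chain_def \<A>_def by blast
  qed
  then obtain M where M\<A>: "M \<in> \<A>" and max\<A>: "\<And>X. X \<in> \<A> \<Longrightarrow> M \<subseteq> X \<Longrightarrow> X = M"
    by blast
  from M\<A> have M: "lattice_filter M" "D \<subseteq> M" "M \<inter> I = {}"
    by (simp_all add: \<A>_def)
  have max: "X = M" if "lattice_filter X" "M \<subseteq> X" "X \<inter> I = {}" for X
    using max\<A>[of X] that M(2) by (simp add: \<A>_def)
  note inf_in = lattice_filter_inf[OF M(1)] and down = lattice_ideal_down[OF I]
  \<comment> \<open>Adjoining \<open>x\<close> to \<open>M\<close> would otherwise give a filter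
    still disjoint from \<open>I\<close>, against maximality.\<close>
  have meets: "\<exists>m\<in>M. inf m x \<in> I" if "x \<notin> M" for x
  proof (rule ccontr)
    assume no: "\<not> (\<exists>m\<in>M. inf m x \<in> I)"
    have "{z. \<exists>d\<in>M. inf d x \<le> z} = M"
    proof (rule max[OF lattice_filter_adjoin[OF M(1)]])
      show "M \<subseteq> {z. \<exists>d\<in>M. inf d x \<le> z}" by (auto intro: inf.coboundedI1)
      show "{z. \<exists>d\<in>M. inf d x \<le> z} \<inter> I = {}" using no down by blast
    qed
    moreover have "x \<in> {z. \<exists>d\<in>M. inf d x \<le> z}"
      using lattice_filter_nonempty[OF M(1)] by (auto intro: inf_le2)
    ultimately show False using that by blast
  qed
  have "prime_filter M"
    unfolding prime_filter_def
  proof (intro conjI allI impI)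
    show "lattice_filter M" by fact
    show "M \<noteq> UNIV" using M(3) lattice_ideal_nonempty[OF I] by blast
  next
    fix x y assume xy: "sup x y \<in> M"
    show "x \<in> M \<or> y \<in> M"
    proof (rule ccontr)
      assume "\<not> (x \<in> M \<or> y \<in> M)"
      then obtain m n where mn: "m \<in> M" "inf m x \<in> I" "n \<in> M" "inf n y \<in> I"
        using meets by blast
      \<comment> \<open>Passing to \<open>inf m n\<close> gives one element of \<open>M\<close> that
        works for both \<open>x\<close> and \<open>y\<close>, so that distributivity
        applies.\<close>
      have "inf (inf m n) x \<in> I" "inf (inf m n) y \<in> I"
        using mn down by (meson inf_le1 inf_le2 inf_mono order_refl)+
      then have "inf (inf m n) (sup x y) \<in> I"
        by (simp add: inf_sup_distrib1 lattice_ideal_sup[OF I])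
      moreover have "inf (inf m n) (sup x y) \<in> M"
        using mn xy by (intro inf_in)
      ultimately show False using M(3) by blast
    qed
  qed
  then show thesis using that M by blast
qed

lemma prime_filter_separates_point:
  fixes I :: "'a::distrib_lattice set"
  assumes "lattice_ideal I" and "a \<notin> I"
  obtains T where "prime_filter T" "a \<in> T" "T \<inter> I = {}"
proof -
  have "lattice_filter {a..}" by (auto simp: lattice_filter_def)
  moreover have "{a..} \<inter> I = {}" using assms by (auto dest: lattice_ideal_down)
  ultimately show thesis
    using assms(1) that by (metis atLeast_iff order_refl prime_filter_separation subsetD)
qed

text \<open>Primality is closure of the complement under \<open>sup\<close>, and properness makes
  the complement nonempty.\<close>

lemma lattice_ideal_Compl_prime_filter:
  assumes "prime_filter T"
  shows "lattice_ideal (- T)"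
  using prime_filterD[OF assms] unfolding lattice_ideal_def
  by (auto intro: lattice_filter_up)

lemma bot_notin_prime_filter:
  fixes T :: "'a::bounded_lattice set"
  assumes "prime_filter T"
  shows "bot \<notin> T"
  using prime_filterD[OF assms] by (meson bot_least lattice_filter_up)

section \<open>Compactness of the Priestley topology\<close>

lemma lattice_filter_finite_lower_bound:
  assumes "lattice_filter T" and "finite X" and "X \<subseteq> T"
  shows "\<exists>w\<in>T. \<forall>x\<in>X. w \<le> x"
  using assms(2,3)
proof (induction X rule: finite_induct)
  case empty
  then show ?case using lattice_filter_nonempty[OF assms(1)] by auto
next
  case (insert x X)
  then obtain w where "w \<in> T" "\<forall>x\<in>X. w \<le> x" by auto
  moreover have "inf x w \<in> T"
    using assms(1) insert.prems \<open>w \<in> T\<close> by (auto intro: lattice_filter_inf)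
  ultimately show ?case
    by (intro bexI[of _ "inf x w"]) (auto intro: le_infI2)
qed

lemma lattice_ideal_finite_upper_bound:
  assumes "lattice_ideal I" and "finite X" and "X \<subseteq> I"
  shows "\<exists>w\<in>I. \<forall>x\<in>X. x \<le> w"
  using assms(2,3)
proof (induction X rule: finite_induct)
  case empty
  then show ?case using lattice_ideal_nonempty[OF assms(1)] by auto
next
  case (insert x X)
  then obtain w where "w \<in> I" "\<forall>x\<in>X. x \<le> w" by auto
  moreover have "sup x w \<in> I"
    using assms(1) insert.prems \<open>w \<in> I\<close> by (auto intro: lattice_ideal_sup)
  ultimately show ?case
    by (intro bexI[of _ "sup x w"]) (auto intro: le_supI2)
qed

text \<open>This is the filter generated by \<open>B\<close>: that the meet of a finite
  \<open>X\<close> lies below \<open>z\<close> is expressed through all lower bounds of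
  \<open>X\<close>. The empty \<open>X\<close> contributes \<open>top\<close>.\<close>

lemma lattice_filter_generated:
  fixes B :: "'a::bounded_lattice set"
  shows "lattice_filter {z. \<exists>X. finite X \<and> X \<subseteq> B \<and> (\<forall>w. (\<forall>x\<in>X. w \<le> x) \<longrightarrow> w \<le> z)}"
    (is "lattice_filter ?D")
  unfolding lattice_filter_def
proof (intro conjI ballI allI impI)
  have "top \<in> ?D" by auto
  then show "?D \<noteq> {}" by blast
next
  fix x y assume "x \<in> ?D" "x \<le> y"
  then show "y \<in> ?D" by (blast intro: order_trans)
next
  fix x y assume "x \<in> ?D" "y \<in> ?D"
  then obtain X Y where "finite X" "X \<subseteq> B" "\<forall>w. (\<forall>x\<in>X. w \<le> x) \<longrightarrow> w \<le> x"
    "finite Y" "Y \<subseteq> B" "\<forall>w. (\<forall>x\<in>Y. w \<le> x) \<longrightarrow> w \<le> y" by blast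
  then show "inf x y \<in> ?D"
    by (intro CollectI exI[of _ "X \<union> Y"]) auto
qed

text \<open>Order dual of the previous lemma, with the empty \<open>X\<close> contributing
  \<open>bot\<close>.\<close>

lemma lattice_ideal_generated:
  fixes B :: "'a::bounded_lattice set"
  shows "lattice_ideal {z. \<exists>X. finite X \<and> X \<subseteq> B \<and> (\<forall>w. (\<forall>x\<in>X. x \<le> w) \<longrightarrow> z \<le> w)}"
    (is "lattice_ideal ?I")
  unfolding lattice_ideal_def
proof (intro conjI ballI allI impI)
  have "bot \<in> ?I" by auto
  then show "?I \<noteq> {}" by blast
next
  fix x y assume "x \<in> ?I" "y \<le> x"
  then show "y \<in> ?I" by (blast intro: order_trans)
next
  fix x y assume "x \<in> ?I" "y \<in> ?I"
  then obtain X Y where "finite X" "X \<subseteq> B" "\<forall>w. (\<forall>x\<in>X. x \<le> w) \<longrightarrow> x \<le> w"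
    "finite Y" "Y \<subseteq> B" "\<forall>w. (\<forall>x\<in>Y. x \<le> w) \<longrightarrow> y \<le> w" by blast
  then show "sup x y \<in> ?I"
    by (intro CollectI exI[of _ "X \<union> Y"]) auto
qed

text \<open>The cover says that no prime filter contains \<open>B\<close> and misses
  \<open>A\<close>. By separation the filter generated by \<open>B\<close> then meets the ideal
  generated by \<open>A\<close>, and the finite sets witnessing a common element index the
  subcover.\<close>

lemma prime_filters_finite_subcover:
  fixes A B :: "'a::{distrib_lattice,bounded_lattice} set"
  assumes cover: "prime_filters \<subseteq> (\<Union>a\<in>A. sigma a) \<union> (\<Union>b\<in>B. prime_filters - sigma b)"
  obtains A' B' where "finite A'" "A' \<subseteq> A" "finite B'" "B' \<subseteq> B"
    "prime_filters \<subseteq> (\<Union>a\<in>A'. sigma a) \<union> (\<Union>b\<in>B'. prime_filters - sigma b)"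
proof -
  define D where "D = {z. \<exists>X. finite X \<and> X \<subseteq> B \<and> (\<forall>w. (\<forall>x\<in>X. w \<le> x) \<longrightarrow> w \<le> z)}"
  define I where "I = {z. \<exists>X. finite X \<and> X \<subseteq> A \<and> (\<forall>w. (\<forall>x\<in>X. x \<le> w) \<longrightarrow> z \<le> w)}"
  have D: "lattice_filter D" unfolding D_def by (rule lattice_filter_generated)
  have I: "lattice_ideal I" unfolding I_def by (rule lattice_ideal_generated)
  have "\<exists>X. finite X \<and> X \<subseteq> B \<and> (\<forall>w. (\<forall>x\<in>X. w \<le> x) \<longrightarrow> w \<le> b)" if "b \<in> B" for b
    using that by (intro exI[of _ "{b}"]) auto
  then have BD: "B \<subseteq> D" by (auto simp: D_def)
  have "\<exists>X. finite X \<and> X \<subseteq> A \<and> (\<forall>w. (\<forall>x\<in>X. x \<le> w) \<longrightarrow> a \<le> w)" if "a \<in> A" for a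
    using that by (intro exI[of _ "{a}"]) auto
  then have AI: "A \<subseteq> I" by (auto simp: I_def)
  have "D \<inter> I \<noteq> {}"
  proof
    assume "D \<inter> I = {}"
    then obtain T where T: "prime_filter T" "D \<subseteq> T" "T \<inter> I = {}"
      using prime_filter_separation[OF D I] by blast
    then have "T \<in> (\<Union>a\<in>A. sigma a) \<union> (\<Union>b\<in>B. prime_filters - sigma b)"
      using cover by (auto simp: prime_filters_def)
    then show False
      using T AI BD unfolding sigma_def by blast
  qed
  then obtain z X Y where X: "finite X" "X \<subseteq> B" and zX: "\<forall>w. (\<forall>x\<in>X. w \<le> x) \<longrightarrow> w \<le> z"
    and Y: "finite Y" "Y \<subseteq> A" and zY: "\<forall>w. (\<forall>y\<in>Y. y \<le> w) \<longrightarrow> z \<le> w"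
    unfolding D_def I_def by blast
  have "T \<in> (\<Union>a\<in>Y. sigma a) \<union> (\<Union>b\<in>X. prime_filters - sigma b)" if T: "prime_filter T" for T
  \<comment> \<open>A prime filter outside the finite subfamily contains \<open>X\<close> and misses
    \<open>Y\<close>; then some \<open>v\<close> in \<open>T\<close> lies below \<open>z\<close> and
    some \<open>w\<close> outside \<open>T\<close> lies above \<open>z\<close>.\<close>
  proof (rule ccontr)
    assume "\<not> ?thesis"
    then have XT: "X \<subseteq> T" and YT: "Y \<subseteq> - T"
      using T by (auto simp: sigma_def prime_filters_def)
    note fil = prime_filter_imp_lattice_filter[OF T]
    obtain v where v: "v \<in> T" "v \<le> z"
      using lattice_filter_finite_lower_bound[OF fil X(1) XT] zX by blast
    obtain w where w: "w \<in> - T" "z \<le> w"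
      using lattice_ideal_finite_upper_bound[OF lattice_ideal_Compl_prime_filter[OF T] Y(1) YT] zY
      by blast
    from v w have "v \<le> w" by auto
    with v w show False using lattice_filter_up[OF fil] by blast
  qed
  then have "prime_filters \<subseteq> (\<Union>a\<in>Y. sigma a) \<union> (\<Union>b\<in>X. prime_filters - sigma b)"
    by (simp add: prime_filters_def subset_iff)
  then show thesis by (rule that[OF Y X])
qed

text \<open>Bridge between the topology in the definition of \<open>priestley_topology\<close> and
  the one in \<open>Alexander_subbase\<close>: both are the coarsest in which the members of the
  subbase are open.\<close>

lemma topology_generated_by_eq_subbase:
  "topology_generated_by \<B> =
    topology (arbitrary union_of (finite intersection_of (\<lambda>x. x \<in> \<B>) relative_to \<Union>\<B>))"
  (is "_ = ?X")
proof (rule topology_eq[THEN iffD2], intro allI iffI)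
  fix S assume "openin (topology_generated_by \<B>) S"
  then have "generate_topology_on \<B> S" by (rule openin_topology_generated_by)
  then show "openin ?X S"
  proof (rule generate_topology_on_coarsest[rotated -1])
    fix S assume "S \<in> \<B>"
    then show "openin ?X S"
      by (simp add: Sup_upper arbitrary_union_of_inc finite_intersection_of_inc openin_subbase
          relative_to_subset_inc)
  qed simp
next
  fix S assume "openin ?X S"
  then show "openin (topology_generated_by \<B>) S"
  proof (rule minimal_topology_subbase[rotated -1])
    show "openin (topology_generated_by \<B>) (\<Union>\<B>)"
      by (metis openin_topspace topology_generated_by_topspace)
  qed (rule topology_generated_by_Basis)
qed

lemma topspace_priestley_topology [simp]: "topspace priestley_topology = prime_filters"
  by (auto simp: priestley_topology_def sigma_def)

lemma openin_sigma: "openin priestley_topology (sigma a)"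
  unfolding priestley_topology_def by (rule topology_generated_by_Basis) simp

lemma closedin_sigma: "closedin priestley_topology (sigma a)"
  unfolding closedin_def topspace_priestley_topology
  by (auto simp: priestley_topology_def sigma_def intro!: topology_generated_by_Basis)

text \<open>By Alexander's subbase theorem it suffices to treat covers by sets
  \<open>sigma a\<close> and their complements, which \<open>prime_filters_finite_subcover\<close>
  reduces to finite ones.\<close>

lemma compact_space_priestley_topology:
  "compact_space (priestley_topology :: 'a::{distrib_lattice,bounded_lattice} set topology)"
proof (rule Alexander_subbase)
  let ?neg = "\<lambda>a :: 'a. prime_filters - sigma a"
  let ?B = "range sigma \<union> range ?neg"
  show "topology (arbitrary union_of (finite intersection_of (\<lambda>x. x \<in> ?B) relative_to \<Union>?B))
      = priestley_topology"
    unfolding priestley_topology_def by (rule topology_generated_by_eq_subbase[symmetric])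
  fix C assume C: "C \<subseteq> ?B" and U: "\<Union>C = topspace (priestley_topology :: 'a set topology)"
  have "prime_filters \<subseteq> (\<Union>a\<in>{a. sigma a \<in> C}. sigma a) \<union> (\<Union>b\<in>{b. ?neg b \<in> C}. ?neg b)"
  proof
    fix T :: "'a set" assume "T \<in> prime_filters"
    then obtain V where "V \<in> C" "T \<in> V" using U by auto
    then show "T \<in> (\<Union>a\<in>{a. sigma a \<in> C}. sigma a) \<union> (\<Union>b\<in>{b. ?neg b \<in> C}. ?neg b)"
      using C by auto
  qed
  then obtain A' B' where *: "finite A'" "A' \<subseteq> {a. sigma a \<in> C}" "finite B'" "B' \<subseteq> {b. ?neg b \<in> C}"
    "prime_filters \<subseteq> (\<Union>a\<in>A'. sigma a) \<union> (\<Union>b\<in>B'. ?neg b)"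
    by (rule prime_filters_finite_subcover)
  show "\<exists>C'. finite C' \<and> C' \<subseteq> C \<and> \<Union>C' = topspace (priestley_topology :: 'a set topology)"
    using * by (intro exI[of _ "sigma ` A' \<union> ?neg ` B'"]) (auto simp: sigma_def)
qed

section \<open>Ideals and closed downsets\<close>

lemma rho_sigma_ideal:
  fixes I :: "'a::distrib_lattice set"
  assumes "lattice_ideal I"
  shows "rho (sigma_ideal I) = I"
proof
  show "I \<subseteq> rho (sigma_ideal I)"
    by (auto simp: rho_def sigma_ideal_def)
  show "rho (sigma_ideal I) \<subseteq> I"
  proof
    fix a assume a: "a \<in> rho (sigma_ideal I)"
    show "a \<in> I"
    proof (rule ccontr)
      assume "a \<notin> I"
      then obtain T where "prime_filter T" "a \<in> T" "T \<inter> I = {}"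
        using prime_filter_separates_point[OF assms] by blast
      with a show False by (auto simp: rho_def sigma_ideal_def prime_filters_def)
    qed
  qed
qed

lemma sigma_ideal_rho:
  fixes Z :: "'a::{distrib_lattice,bounded_lattice} set set"
  assumes closed: "closedin priestley_topology Z" and down: "downward_closed Z"
  shows "sigma_ideal (rho Z) = Z"
proof
  have ZX: "Z \<subseteq> prime_filters" using down by (simp add: downward_closed_def)
  then show "Z \<subseteq> sigma_ideal (rho Z)"
    by (auto simp: rho_def sigma_ideal_def)
  show "sigma_ideal (rho Z) \<subseteq> Z"
  proof
    fix T assume "T \<in> sigma_ideal (rho Z)"
    then have T: "prime_filter T" and TZ: "T \<subseteq> \<Union>Z"
      by (auto simp: sigma_ideal_def rho_def prime_filters_def)
    note fil = prime_filter_imp_lattice_filter[OF T]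
    have "compactin priestley_topology Z"
      using closed compact_space_priestley_topology closedin_compact_space by blast
    moreover have "\<forall>C\<in>sigma ` T. closedin priestley_topology C"
      by (auto intro: closedin_sigma)
    \<comment> \<open>A finite part \<open>X\<close> of \<open>T\<close> has a lower bound
      \<open>w\<close> in \<open>T\<close>. A member of \<open>Z\<close> containing \<open>w\<close>
      contains all of \<open>X\<close>, which is the finite intersection property.\<close>
    moreover have "Z \<inter> \<Inter>\<F> \<noteq> {}" if fin: "finite \<F>" and sub: "\<F> \<subseteq> sigma ` T" for \<F>
    proof -
      obtain X where X: "finite X" "X \<subseteq> T" "\<F> = sigma ` X"
        using finite_subset_image[OF fin sub] by blast
      obtain w where w: "w \<in> T" "\<forall>x\<in>X. w \<le> x"
        using lattice_filter_finite_lower_bound[OF fil X(1,2)] by blast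
      obtain S where S: "S \<in> Z" "w \<in> S" using w TZ by blast
      have "S \<in> prime_filters" using S ZX by blast
      moreover from this have "lattice_filter S"
        by (simp add: prime_filters_def prime_filter_def)
      then have "X \<subseteq> S"
        using S w lattice_filter_up by blast
      ultimately show ?thesis using S X by (auto simp: sigma_def)
    qed
    ultimately have "Z \<inter> \<Inter>(sigma ` T) \<noteq> {}"
      unfolding compactin_fip by blast
    then obtain S where "S \<in> Z" "T \<subseteq> S" by (auto simp: sigma_def)
    then show "T \<in> Z" using down T unfolding downward_closed_def prime_filters_def by blast
  qed
qed

text \<open>Both \<open>rho\<close> and \<open>sigma_ideal\<close> reverse inclusion; applying
  \<open>sigma_ideal\<close> to \<open>rho Z \<subseteq> rho Y\<close> recovers the inclusion of the
  original sets.\<close>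

lemma rho_antimono_iff:
  assumes "sigma_ideal (rho Y) = Y" and "sigma_ideal (rho Z) = Z"
  shows "rho Z \<subseteq> rho Y \<longleftrightarrow> Y \<subseteq> Z"
proof
  assume "rho Z \<subseteq> rho Y"
  then have "sigma_ideal (rho Y) \<subseteq> sigma_ideal (rho Z)" by (auto simp: sigma_ideal_def)
  with assms show "Y \<subseteq> Z" by simp
qed (auto simp: rho_def)

lemma closedin_sigma_ideal: "closedin priestley_topology (sigma_ideal I)"
proof -
  have "prime_filters - sigma_ideal I = (\<Union>a\<in>I. sigma a)"
    by (auto simp: sigma_ideal_def sigma_def)
  then show ?thesis
    by (auto simp: closedin_def openin_sigma) (auto simp: sigma_ideal_def)
qed

lemma downward_closed_sigma_ideal: "downward_closed (sigma_ideal I)"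
  by (auto simp: downward_closed_def sigma_ideal_def)

text \<open>\<open>rho Z\<close> is the intersection of the prime ideals \<open>- T\<close> with
  \<open>T\<close> in \<open>Z\<close>. All of them contain \<open>bot\<close>, so the intersection
  is nonempty.\<close>

lemma lattice_ideal_rho:
  fixes Z :: "'a::bounded_lattice set set"
  assumes "Z \<subseteq> prime_filters"
  shows "lattice_ideal (rho Z)"
proof -
  have Z: "lattice_ideal (- T)" "bot \<notin> T" if "T \<in> Z" for T
    using that assms lattice_ideal_Compl_prime_filter bot_notin_prime_filter
    by (auto simp: prime_filters_def)
  have "bot \<in> rho Z" using Z(2) by (auto simp: rho_def)
  moreover have "y \<in> rho Z" if "x \<in> rho Z" "y \<le> x" for x y
    using lattice_ideal_down[OF Z(1)] that by (auto simp: rho_def)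
  moreover have "sup x y \<in> rho Z" if "x \<in> rho Z" "y \<in> rho Z" for x y
    using lattice_ideal_sup[OF Z(1)] that by (auto simp: rho_def)
  ultimately show ?thesis
    unfolding lattice_ideal_def by auto
qed

section \<open>Tense structure\<close>

context tDL_algebra
begin

text \<open>The axioms are symmetric between future and past, so every result on \<open>G\<close>
  and \<open>F\<close> also yields its mirror image for \<open>H\<close> and
  \<open>P\<close>.\<close>

lemma converse_tDL_algebra: "tDL_algebra H G P F"
  by unfold_locales
    (fact G_top H_top G_inf H_inf le_G_P le_H_F G_sup_le H_sup_le F_bot P_bot F_sup P_sup
      P_G_le F_H_le inf_G_F_le inf_H_P_le)+

lemma F_mono: "x \<le> y \<Longrightarrow> F x \<le> F y"
  by (metis F_sup le_iff_sup)

lemma G_mono: "x \<le> y \<Longrightarrow> G x \<le> G y"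
  by (metis G_inf le_iff_inf)

lemma P_mono: "x \<le> y \<Longrightarrow> P x \<le> P y"
  by (metis P_sup le_iff_sup)

text \<open>The two adjunctions do the work: \<open>H a\<close> in \<open>T\<close> puts
  \<open>F (H a)\<close>, hence \<open>a\<close>, in \<open>S\<close>; and \<open>a\<close> in
  \<open>S\<close> puts \<open>G (P a)\<close> in \<open>S\<close>, hence \<open>P a\<close> in
  \<open>T\<close>.\<close>

lemma canonical_rel_imp:
  assumes "(S, T) \<in> canonical_rel G F"
  shows "(T, S) \<in> canonical_rel H P"
proof -
  have ST: "S \<in> prime_filters" "T \<in> prime_filters" and GT: "{a. G a \<in> S} \<subseteq> T"
    and TF: "T \<subseteq> {a. F a \<in> S}"
    using assms by (auto simp: canonical_rel_def)
  have "lattice_filter S" using ST by (simp add: prime_filters_def prime_filter_def)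
  note up = lattice_filter_up[OF this]
  have "a \<in> S" if "H a \<in> T" for a
    using TF that up F_H_le by blast
  moreover have "P a \<in> T" if "a \<in> S" for a
    using GT that up le_G_P by blast
  ultimately show ?thesis using ST by (auto simp: canonical_rel_def)
qed

lemma converse_canonical_rel: "(canonical_rel G F)\<inverse> = canonical_rel H P"
  using canonical_rel_imp tDL_algebra.canonical_rel_imp[OF converse_tDL_algebra] by auto

text \<open>Membership in the canonical relation is a separation problem: \<open>T\<close> must
  extend the filter of all \<open>d\<close> with \<open>G d\<close> in \<open>S\<close> and avoid
  the ideal of all \<open>b\<close> with \<open>F b\<close> outside \<open>S\<close>. To capture
  \<open>a\<close> as well, it is adjoined to the filter first.\<close>

lemma canonical_successor:
  assumes S: "prime_filter S" and a: "F a \<in> S"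
  obtains T where "(S, T) \<in> canonical_rel G F" "a \<in> T"
proof -
  note fil = prime_filter_imp_lattice_filter[OF S]
  note up = lattice_filter_up[OF fil] and inf_in = lattice_filter_inf[OF fil]
  have G_filter: "lattice_filter {d. G d \<in> S}"
    unfolding lattice_filter_def
  proof (intro conjI ballI allI impI)
    have "G top \<in> S" using up[OF a] by (simp add: G_top)
    then show "{d. G d \<in> S} \<noteq> {}" by blast
  qed (use up G_mono inf_in in \<open>auto simp: G_inf\<close>)
  define D where "D = {z. \<exists>d\<in>{d. G d \<in> S}. inf d a \<le> z}"
  have D: "lattice_filter D"
    unfolding D_def by (rule lattice_filter_adjoin[OF G_filter])
  have I: "lattice_ideal {b. F b \<notin> S}"
    unfolding lattice_ideal_def
  proof (intro conjI ballI allI impI)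
    have "F bot \<notin> S" using bot_notin_prime_filter[OF S] by (simp add: F_bot)
    then show "{b. F b \<notin> S} \<noteq> {}" by blast
  next
    fix x y assume "x \<in> {b. F b \<notin> S}" "y \<in> {b. F b \<notin> S}"
    then show "sup x y \<in> {b. F b \<notin> S}" using prime_filter_sup[OF S] by (auto simp: F_sup)
  qed (use up F_mono in blast)
  \<comment> \<open>Disjointness of filter and ideal comes from \<open>inf_G_F_le\<close>, which
    gives \<open>inf (G d) (F a) \<le> F (inf d a)\<close>, and monotonicity of
    \<open>F\<close>.\<close>
  have DF: "F b \<in> S" if "b \<in> D" for b
  proof -
    obtain d where d: "G d \<in> S" "inf d a \<le> b" using \<open>b \<in> D\<close> by (auto simp: D_def)
    have "inf (G d) (F a) \<in> S" using d a by (intro inf_in)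
    moreover have "inf (G d) (F a) \<le> F b"
      using inf_G_F_le[of d a] F_mono[OF d(2)] by (rule order_trans)
    ultimately show ?thesis by (rule up)
  qed
  then have "D \<inter> {b. F b \<notin> S} = {}" by blast
  from prime_filter_separation[OF D I this] obtain T
    where T: "prime_filter T" "D \<subseteq> T" "T \<inter> {b. F b \<notin> S} = {}" by blast
  have "{d. G d \<in> S} \<subseteq> D" unfolding D_def by (auto intro: inf_le1)
  moreover have "a \<in> D"
    using lattice_filter_nonempty[OF G_filter] unfolding D_def by (auto intro: inf_le2)
  ultimately show thesis
    using T S by (intro that[of T]) (auto simp: canonical_rel_def prime_filters_def)
qed

text \<open>Reversing the relation interchanges (tc1) and (tc2).\<close>

lemma tPS_set_converse: "tPS_set G F Y \<longleftrightarrow> tPS_set H P Y"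
  unfolding tPS_set_def Let_def converse_canonical_rel[symmetric] converse_converse by blast

section \<open>Passage between tPS-sets and tense ideals\<close>

lemma F_rho:
  assumes tPS: "tPS_set G F Z" and a: "a \<in> rho Z"
  shows "F a \<in> rho Z"
proof (rule ccontr)
  assume "F a \<notin> rho Z"
  then obtain S where S: "S \<in> Z" "F a \<in> S" by (auto simp: rho_def)
  have "prime_filter S" using S tPS by (auto simp: tPS_set_def prime_filters_def)
  then obtain T where T: "(S, T) \<in> canonical_rel G F" "a \<in> T"
    using canonical_successor S by blast
  have "S \<in> prime_filters" "T \<in> prime_filters"
    using T by (auto simp: canonical_rel_def)
  \<comment> \<open>This is the witness \<open>w2\<close> of (tc1). Since \<open>W\<close> contains
    \<open>T\<close>, it contains \<open>a\<close>, although \<open>a\<close> lies in no member of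
    \<open>Z\<close>.\<close>
  then have "\<exists>W \<in> canonical_rel G F `` {S} \<inter> Z. T \<subseteq> W"
    using tPS S T unfolding tPS_set_def Let_def by blast
  then show False using T a by (auto simp: rho_def)
qed

lemma tense_ideal_rho:
  assumes "tPS_set G F Z"
  shows "tense_ideal F P (rho Z)"
proof -
  have "Z \<subseteq> prime_filters" using assms by (simp add: tPS_set_def)
  moreover have "tPS_set H P Z" using assms by (simp add: tPS_set_converse)
  ultimately show ?thesis
    using F_rho[OF assms] tDL_algebra.F_rho[OF converse_tDL_algebra]
    by (simp add: tense_ideal_def lattice_ideal_rho)
qed

text \<open>An element \<open>a\<close> common to \<open>T\<close> and \<open>I\<close> would put
  \<open>F a\<close> into both \<open>S\<close> and \<open>I\<close>.\<close>

lemma sigma_ideal_successor: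
  assumes "tense_ideal F P I" and "S \<in> sigma_ideal I" and "(S, T) \<in> canonical_rel G F"
  shows "T \<in> sigma_ideal I"
  using assms unfolding tense_ideal_def sigma_ideal_def canonical_rel_def by blast

lemma tPS_set_sigma_ideal:
  assumes I: "tense_ideal F P I"
  shows "tPS_set G F (sigma_ideal I)"
proof -
  \<comment> \<open>Predecessors are successors for the mirror algebra, and \<open>I\<close> is a
    tense ideal there too.\<close>
  have "tense_ideal P F I" using I by (auto simp: tense_ideal_def)
  then have "S \<in> sigma_ideal I" if "T \<in> sigma_ideal I" "(S, T) \<in> canonical_rel G F" for S T
    using tDL_algebra.sigma_ideal_successor[OF converse_tDL_algebra] that canonical_rel_imp by blast
  moreover have "sigma_ideal I \<subseteq> prime_filters" by (auto simp: sigma_ideal_def)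
  ultimately show ?thesis
    unfolding tPS_set_def Let_def using sigma_ideal_successor[OF I] by blast
qed

section \<open>Joins and meets of tense ideals\<close>

lemma tense_idealD:
  assumes "tense_ideal F P I"
  shows "lattice_ideal I" and "x \<in> I \<Longrightarrow> F x \<in> I" and "x \<in> I \<Longrightarrow> P x \<in> I"
  using assms by (auto simp: tense_ideal_def)

text \<open>The lattice ideal generated by \<open>I\<close> and \<open>J\<close> is again tense
  because \<open>F\<close> and \<open>P\<close> are monotone and preserve
  \<open>sup\<close>.\<close>

lemma tense_ideal_join:
  assumes I: "tense_ideal F P I" and J: "tense_ideal F P J"
  shows "tense_ideal F P {z. \<exists>x\<in>I. \<exists>y\<in>J. z \<le> sup x y}" (is "tense_ideal F P ?K")
  unfolding tense_ideal_def lattice_ideal_def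
proof (intro conjI ballI allI impI)
  show "?K \<noteq> {}"
    using lattice_ideal_nonempty[OF tense_idealD(1)[OF I]]
      lattice_ideal_nonempty[OF tense_idealD(1)[OF J]] by blast
next
  fix u v assume "u \<in> ?K" "v \<le> u"
  then show "v \<in> ?K" by (blast intro: order_trans)
next
  fix u v assume "u \<in> ?K" "v \<in> ?K"
  then obtain x y x' y' where *: "x \<in> I" "y \<in> J" "u \<le> sup x y" "x' \<in> I" "y' \<in> J" "v \<le> sup x' y'"
    by blast
  then have "sup u v \<le> sup (sup x x') (sup y y')"
    by (metis sup.mono sup.assoc sup.left_commute)
  moreover have "sup x x' \<in> I" "sup y y' \<in> J"
    using * I J by (blast intro: lattice_ideal_sup tense_idealD(1))+
  ultimately show "sup u v \<in> ?K" by blast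
next
  fix u assume "u \<in> ?K"
  then obtain x y where *: "x \<in> I" "y \<in> J" "u \<le> sup x y" by blast
  then have "F u \<le> sup (F x) (F y)" "P u \<le> sup (P x) (P y)"
    using F_mono P_mono by (simp_all flip: F_sup P_sup)
  moreover have "F x \<in> I" "P x \<in> I" "F y \<in> J" "P y \<in> J"
    using * I J by (blast intro: tense_idealD)+
  ultimately show "F u \<in> ?K" "P u \<in> ?K" by blast+
qed

lemma tense_ideal_Int:
  assumes I: "tense_ideal F P I" and J: "tense_ideal F P J"
  shows "tense_ideal F P (I \<inter> J)"
proof -
  \<comment> \<open>The common element \<open>bot\<close> keeps the intersection nonempty.\<close>
  have "bot \<in> I" "bot \<in> J"
    using I J by (meson bot_least lattice_ideal_nonempty lattice_ideal_down tense_idealD(1))+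
  then show ?thesis
    using I J unfolding tense_ideal_def lattice_ideal_def by auto
qed

lemma lattice_tense_ideal_lattice: "Lattice.lattice (tense_ideal_lattice F P)"
proof -
  let ?L = "tense_ideal_lattice F P"
  have carrier: "carrier ?L = {I. tense_ideal F P I}" and le: "le ?L = (\<subseteq>)"
    by (simp_all add: tense_ideal_lattice_def)
  interpret partial_order ?L
    unfolding tense_ideal_lattice_def by (rule partial_order_inclusion_order)
  show ?thesis
  proof
    fix I J assume "I \<in> carrier ?L" "J \<in> carrier ?L"
    then have IJ: "tense_ideal F P I" "tense_ideal F P J" by (simp_all add: carrier)
    let ?K = "{z. \<exists>x\<in>I. \<exists>y\<in>J. z \<le> sup x y}"
    have "I \<subseteq> ?K" "J \<subseteq> ?K"
      using IJ[THEN tense_idealD(1), THEN lattice_ideal_nonempty]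
      by (blast intro: sup_ge1 sup_ge2)+
    moreover have "?K \<subseteq> M" if "tense_ideal F P M" "I \<subseteq> M" "J \<subseteq> M" for M
      using tense_idealD(1)[OF that(1)] that(2,3)
      by (blast intro: lattice_ideal_down lattice_ideal_sup)
    ultimately have "is_lub ?L ?K {I, J}"
      using IJ tense_ideal_join[OF IJ] by (auto simp: least_def Upper_def carrier le)
    then show "\<exists>K. is_lub ?L K {I, J}" ..
    have "is_glb ?L (I \<inter> J) {I, J}"
      using IJ tense_ideal_Int[OF IJ] by (auto simp: greatest_def Lower_def carrier le)
    then show "\<exists>K. is_glb ?L K {I, J}" ..
  qed
qed

end

theorem theorem4p13:
  fixes G H F P :: "'a::{distrib_lattice,bounded_lattice} \<Rightarrow> 'a"
  assumes "tDL_algebra G H F P"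
  shows "Lattice.lattice (tPS_downset_lattice G F)
    \<and> Lattice.lattice (tense_ideal_lattice F P)
    \<and> lattice_isomorphism (tPS_downset_lattice G F) (inv_gorder (tense_ideal_lattice F P)) rho
    \<and> (\<forall>Z \<in> carrier (tPS_downset_lattice G F). sigma_ideal (rho Z) = Z)
    \<and> (\<forall>I \<in> carrier (tense_ideal_lattice F P).
          sigma_ideal I \<in> carrier (tPS_downset_lattice G F) \<and> rho (sigma_ideal I) = I)"
proof -
  interpret tDL_algebra G H F P by fact
  let ?L = "tPS_downset_lattice G F" and ?M = "tense_ideal_lattice F P"
  have L: "carrier ?L = {Z. tPS_set G F Z \<and> closedin priestley_topology Z \<and> downward_closed Z}"
    "le ?L = (\<subseteq>)" and M: "carrier ?M = {I. tense_ideal F P I}" "le ?M = (\<subseteq>)"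
    by (simp_all add: tPS_downset_lattice_def tense_ideal_lattice_def)
  have sr: "sigma_ideal (rho Z) = Z" if "Z \<in> carrier ?L" for Z
    using that by (simp add: L sigma_ideal_rho)
  have rs: "rho (sigma_ideal I) = I" if "I \<in> carrier ?M" for I
    using that by (simp add: M tense_ideal_def rho_sigma_ideal)
  have s: "sigma_ideal I \<in> carrier ?L" if "I \<in> carrier ?M" for I
    using that by (simp add: L M tPS_set_sigma_ideal closedin_sigma_ideal downward_closed_sigma_ideal)
  have r: "rho Z \<in> carrier ?M" if "Z \<in> carrier ?L" for Z
    using that by (simp add: L M tense_ideal_rho)
  have PO: "partial_order ?L"
    unfolding tPS_downset_lattice_def by (rule partial_order_inclusion_order)
  \<comment> \<open>Since \<open>rho\<close> reverses inclusion, the dual of \<open>?M\<close> is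
    the lattice whose structure is transported to \<open>?L\<close>.\<close>
  have LM: "Lattice.lattice (inv_gorder ?M)"
    using lattice_tense_ideal_lattice by (rule Lattice.lattice.dual_lattice)
  have bij: "bij_betw rho (carrier ?L) (carrier (inv_gorder ?M))"
    by (rule bij_betw_byWitness[where f' = sigma_ideal]) (use sr rs s r in auto)
  have le: "Y \<sqsubseteq>\<^bsub>?L\<^esub> Z \<longleftrightarrow> rho Y \<sqsubseteq>\<^bsub>inv_gorder ?M\<^esub> rho Z"
    if "Y \<in> carrier ?L" "Z \<in> carrier ?L" for Y Z
    using rho_antimono_iff[OF sr[OF that(1)] sr[OF that(2)]] by (simp add: L M)
  show ?thesis
    using order_iso_imp_lattice[OF PO LM bij le] order_iso_imp_lattice_isomorphism[OF PO LM bij le]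
      lattice_tense_ideal_lattice sr rs s by blast
qed

end
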